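(* Let $q\ge 2$ be a prime power. Then $A_q(7,4) \leq (q^2-q+1)\begin{bmatrix}7\\1\end{bmatrix}_q + 2(q^5+q^3+1)$.
   Context: $\begin{bmatrix}n\\1\end{bmatrix}_q=\frac{q^n-1}{q-1}$. For $V=\mathbb{F}_q^n$, $\mathcal{P}(V)$ is the set of all subspaces of $V$ with the subspace metric $d_s(U,W)=\dim(U+W)-\dim(U\cap W)$. $A_q(n,d)$ denotes the maximum cardinality of a subset $\mathcal{C}\subseteq\mathcal{P}(\mathbb{F}_q^n)$ with $d_s(U,W)\ge d$ for all distinct $U,W\in\mathcal{C}$. *)

theory Defs
  imports "HOL-Analysis.Cartesian_Space" "HOL-Number_Theory.Prime_Powers"
begin

definition gauss_number :: "nat \<Rightarrow> nat \<Rightarrow> real" where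
  "gauss_number q n = (real q ^ n - 1) / (real q - 1)"

definition subspace_sum :: "('a::field ^ 'n) set \<Rightarrow> ('a ^ 'n) set \<Rightarrow> ('a ^ 'n) set" where
  "subspace_sum U W = {u + w | u w. u \<in> U \<and> w \<in> W}"

definition subspace_dist :: "('a::field ^ 'n) set \<Rightarrow> ('a ^ 'n) set \<Rightarrow> int" where
  "subspace_dist U W = int (vec.dim (subspace_sum U W)) - int (vec.dim (U \<inter> W))"

definition is_subspace_code :: "('a::field ^ 'n) set set \<Rightarrow> nat \<Rightarrow> bool" where
  "is_subspace_code C d \<longleftrightarrow>
     (\<forall>U\<in>C. vec.subspace U) \<and>
     (\<forall>U\<in>C. \<forall>W\<in>C. U \<noteq> W \<longrightarrow> int d \<le> subspace_dist U W)"

(* For a field 'a with q elements and an index type 'n with n elements,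
   subspace_code_max TYPE('a) TYPE('n) d is A_q(n,d).  The set under Max is finite because
   the ambient space is, and nonempty because the empty code is admitted. *)
definition subspace_code_max ::
  "'a::{field,finite} itself \<Rightarrow> 'n::finite itself \<Rightarrow> nat \<Rightarrow> nat" where
  "subspace_code_max _ _ d = Max {card C | C :: ('a ^ 'n) set set. is_subspace_code C d}"

end

theory Submission
  imports Defs "HOL-Analysis.Convex"
begin

text \<open>
  Split a code by dimension. Codewords of dimension at most 2 form a partial line spread (or there
  is only one of them), and those of dimension at least 5 reduce to this case by passing to
  orthogonal complements. A partial spread with \<open>q^5 + q^3 + 1 + e\<close> lines, \<open>e \<ge> 1\<close>,
  is impossible: modulo \<open>q\<close> every hyperplane would contain at least \<open>q - e\<close> uncovered points,
  which is more than the average number.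

  For the dimensions 3 and 4, give a codeword weight \<open>1\<close> or \<open>1 / (q^2 + 1)\<close> respectively and
  apply the Cauchy-Schwarz inequality to the total weight of the codewords through a line. Two
  codewords share a line only if both have dimension 4 and they meet in dimension 2. Such a pair
  spans a hyperplane, a given 4-space lies in \<open>q^2 + q + 1\<close> hyperplanes, and each hyperplane
  contains at most \<open>q^4 + q^2 + 1\<close> codewords of dimension 4 (again by Cauchy-Schwarz, now for
  the number of codewords through a point). This makes the second moment just small enough.

  Points and lines are counted through nonzero vectors and ordered pairs of independent vectors,
  and hyperplanes through their nonzero normal vectors.
\<close>

section \<open>Cardinalities of subspaces over a finite field\<close>

lemma card_subspace:
  fixes S :: "('k::{field,finite} ^ 'n::finite) set"
  assumes "vec.subspace S"
  shows "card S = CARD('k) ^ vec.dim S"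
proof -
  obtain B where B: "B \<subseteq> S" "vec.independent B" "S \<subseteq> vec.span B" "card B = vec.dim S"
    using vec.basis_exists by blast
  have fin: "finite B" using B vec.finiteI_independent by blast
  have S: "S = vec.span B"
    using B assms by (metis vec.span_subspace)
  let ?f = "\<lambda>u::'k^'n \<Rightarrow> 'k. \<Sum>b\<in>B. u b *s b"
  have "bij_betw ?f (PiE B (\<lambda>_. UNIV)) S"
    unfolding bij_betw_def
  proof
    show "inj_on ?f (PiE B (\<lambda>_. UNIV))"
    proof (rule inj_onI)
      fix u v assume u: "u \<in> PiE B (\<lambda>_. UNIV)" "v \<in> PiE B (\<lambda>_. UNIV)" and eq: "?f u = ?f v"
      have "(\<Sum>b\<in>B. (u b - v b) *s b) = 0"
        using eq by (simp add: vec.scale_left_diff_distrib sum_subtractf)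
      then have "u b = v b" if "b \<in> B" for b
        using vec.independentD[OF B(2) fin order_refl, of "\<lambda>b. u b - v b" b] that by simp
      then show "u = v" using u by (intro PiE_ext) auto
    qed
    show "?f ` PiE B (\<lambda>_. UNIV) = S"
    proof -
      \<comment> \<open>The coordinate sum only sees \<open>u\<close> on \<open>B\<close>, so
        coefficient functions that are extensional on \<open>B\<close> already reach the whole
        span.\<close>
      have "?f u \<in> ?f ` PiE B (\<lambda>_. UNIV)" for u
        by (rule image_eqI[of _ _ "restrict u B"]) auto
      then show ?thesis
        unfolding S vec.span_finite[OF fin] by auto
    qed
  qed
  then have "card S = card (PiE B (\<lambda>_. UNIV :: 'k set))"
    using bij_betw_same_card by fastforce
  then show ?thesis using fin B(4) by (simp add: card_PiE)
qed

section \<open>Orthogonal complements for the standard bilinear form\<close>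

definition dot :: "'k::field ^ 'n::finite \<Rightarrow> 'k ^ 'n \<Rightarrow> 'k" where
  "dot x y = (\<Sum>i\<in>UNIV. x $ i * y $ i)"

lemma dot_algebra:
  "dot (x + x') y = dot x y + dot x' y" "dot (c *s x) y = c * dot x y" "dot 0 y = 0"
  "dot x (y + y') = dot x y + dot x y'" "dot x (c *s y) = c * dot x y" "dot x 0 = 0"
  "dot x (y - y') = dot x y - dot x y'"
  by (simp_all add: dot_def algebra_simps sum.distrib sum_distrib_left sum_subtractf)

lemma dot_commute: "dot x y = dot y x"
  by (simp add: dot_def mult.commute)

lemma dot_eq_0_imp:
  assumes "\<And>x. dot x y = 0" shows "y = 0"
proof -
  have "y $ i = 0" for i
    using assms[of "axis i 1"] by (simp add: dot_def axis_def if_distrib if_distribR cong: if_cong)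
  then show ?thesis by (simp add: vec_eq_iff)
qed

text \<open>Over a finite field there can be isotropic vectors, so \<open>perp S\<close> may meet
  \<open>S\<close> nontrivially; it is a dual partner of \<open>S\<close>, not a direct
  complement.\<close>

definition perp :: "('k::field ^ 'n::finite) set \<Rightarrow> ('k ^ 'n) set" where
  "perp S = {y. \<forall>x\<in>S. dot x y = 0}"

lemma subspace_perp: "vec.subspace (perp S)"
  unfolding vec.subspace_def perp_def by (auto simp: dot_algebra)

lemma perp_span: "perp (vec.span S) = perp S"
proof
  show "perp (vec.span S) \<subseteq> perp S"
    using vec.span_superset by (force simp: perp_def)
  show "perp S \<subseteq> perp (vec.span S)"
  proof
    fix y assume y: "y \<in> perp S"
    have "vec.subspace {x. dot x y = 0}"
      unfolding vec.subspace_def by (auto simp: dot_algebra)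
    moreover have "S \<subseteq> {x. dot x y = 0}" using y by (auto simp: perp_def)
    ultimately have "vec.span S \<subseteq> {x. dot x y = 0}" by (rule vec.span_minimal[rotated])
    then show "y \<in> perp (vec.span S)" by (auto simp: perp_def)
  qed
qed

lemma perp_antimono: "S \<subseteq> T \<Longrightarrow> perp T \<subseteq> perp S"
  by (auto simp: perp_def)

lemma subset_perp_iff: "S \<subseteq> perp T \<longleftrightarrow> T \<subseteq> perp S"
  unfolding perp_def subset_iff mem_Collect_eq using dot_commute by metis

lemma one_less_CARD_field: "1 < CARD('k::{field,finite})"
proof -
  have "card {0, 1::'k} \<le> CARD('k)" by (rule card_mono) auto
  then show ?thesis by simp
qed

text \<open>Rank-nullity by counting: the dot products of \<open>y\<close> with a basis of
  \<open>S\<close> take at most \<open>CARD('k) ^ vec.dim S\<close> values, and each nonempty fibre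
  is a translate of a subset of \<open>perp S\<close>.\<close>

lemma dim_perp_ge:
  fixes S :: "('k::{field,finite} ^ 'n::finite) set"
  shows "CARD('n) \<le> vec.dim S + vec.dim (perp S)"
proof -
  obtain B where B: "B \<subseteq> S" "vec.independent B" "S \<subseteq> vec.span B" "card B = vec.dim S"
    using vec.basis_exists by blast
  have fin: "finite B" using B vec.finiteI_independent by blast
  have pB: "perp B = perp S"
    using perp_span[of B] perp_antimono[OF B(1)] perp_antimono[OF B(3)] by auto
  let ?g = "\<lambda>y. restrict (\<lambda>b. dot b y) B"
  let ?P = "PiE B (\<lambda>_. UNIV :: 'k set)"
  have finP: "finite ?P" using fin by (simp add: finite_PiE)
  have fibre: "card {y. ?g y = a} \<le> card (perp S)" for a
  proof (cases "\<exists>y0. ?g y0 = a")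
    case True
    then obtain y0 where y0: "?g y0 = a" by blast
    have "(\<lambda>y. y - y0) ` {y. ?g y = a} \<subseteq> perp S"
    proof (clarify)
      fix y assume "a = ?g y"
      then have "\<And>b. b \<in> B \<Longrightarrow> dot b y = dot b y0"
        using y0 by (metis restrict_apply')
      then have "y - y0 \<in> perp B" by (auto simp: perp_def dot_algebra)
      then show "y - y0 \<in> perp S" using pB by simp
    qed
    then have "card ((\<lambda>y. y - y0) ` {y. ?g y = a}) \<le> card (perp S)"
      by (intro card_mono) auto
    then show ?thesis by (simp add: card_image inj_on_def)
  qed auto
  have "(UNIV :: ('k^'n) set) = (\<Union>a\<in>?P. {y. ?g y = a})"
    by (auto intro: restrict_PiE)
  then have "CARD('k^'n) = card (\<Union>a\<in>?P. {y. ?g y = a})" by simp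
  also have "\<dots> \<le> (\<Sum>a\<in>?P. card {y. ?g y = a})" by (rule card_UN_le[OF finP])
  also have "\<dots> \<le> (\<Sum>a\<in>?P. card (perp S))" by (rule sum_mono) (rule fibre)
  also have "\<dots> = CARD('k) ^ (vec.dim S + vec.dim (perp S))"
    using fin B(4) card_subspace[OF subspace_perp, of S]
    by (simp add: card_PiE power_add)
  finally have "CARD('k) ^ CARD('n) \<le> CARD('k) ^ (vec.dim S + vec.dim (perp S))"
    using card_subspace[of "UNIV :: ('k^'n) set"] by (simp add: vec_dim_card)
  then show ?thesis
    using one_less_CARD_field[where 'k='k] power_le_imp_le_exp by blast
qed

text \<open>Extend a basis of \<open>S\<close> by vectors \<open>?T\<close> to a basis of the whole
  space. By nondegeneracy \<open>perp S\<close> and \<open>perp ?T\<close> meet only in 0, so their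
  dimensions sum to at most \<open>CARD('n)\<close>. The lower bounds for \<open>S\<close> and
  \<open>?T\<close> sum to exactly this value, which forces equality in both.\<close>

lemma dim_perp:
  fixes S :: "('k::{field,finite} ^ 'n::finite) set"
  shows "vec.dim S + vec.dim (perp S) = CARD('n)"
proof -
  obtain B where B: "B \<subseteq> S" "vec.independent B" "S \<subseteq> vec.span B" "card B = vec.dim S"
    using vec.basis_exists by blast
  obtain B' where B': "B \<subseteq> B'" "vec.independent B'" "UNIV \<subseteq> vec.span B'"
    by (rule vec.maximal_independent_subset_extend[OF subset_UNIV B(2)])
  have fin: "finite B'" using B' vec.finiteI_independent by blast
  have card': "card B' = CARD('n)"
    using B' vec.basis_card_eq_dim[of B' UNIV] vec_dim_card by (metis subset_UNIV)
  let ?T = "B' - B"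
  have pB: "perp B = perp S"
    using perp_span[of B] perp_antimono[OF B(1)] perp_antimono[OF B(3)] by auto
  have "perp S \<inter> perp ?T = {0}"
  proof -
    have "perp S \<inter> perp ?T \<subseteq> perp B'"
      unfolding pB[symmetric] by (auto simp: perp_def)
    also have "perp B' \<subseteq> perp UNIV"
      using perp_span[of B'] perp_antimono[OF B'(3)] by auto
    also have "perp UNIV \<subseteq> {0 :: 'k^'n}"
      using dot_eq_0_imp by (auto simp: perp_def)
    finally show ?thesis
      using vec.subspace_0[OF subspace_perp] by blast
  qed
  then have "vec.dim (perp S) + vec.dim (perp ?T) \<le> CARD('n)"
    using vec.dim_sums_Int[OF subspace_perp subspace_perp, of S ?T]
      dim_subset_UNIV_cart_gen[of "{x + y |x y. x \<in> perp S \<and> y \<in> perp ?T}"]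
    by simp
  moreover have "vec.dim ?T = CARD('n) - vec.dim S"
  proof -
    have "vec.independent ?T" using B'(2) by (rule vec.independent_mono) auto
    then have "vec.dim ?T = card ?T" by (rule vec.dim_eq_card_independent)
    also have "\<dots> = CARD('n) - vec.dim S"
      using card' B(4) B'(1) fin by (simp add: card_Diff_subset finite_subset)
    finally show ?thesis .
  qed
  moreover have "vec.dim S \<le> CARD('n)" by (rule dim_subset_UNIV_cart_gen)
  ultimately show ?thesis using dim_perp_ge[of S] dim_perp_ge[of ?T] by linarith
qed

lemma perp_perp:
  fixes S :: "('k::{field,finite} ^ 'n::finite) set"
  assumes "vec.subspace S"
  shows "perp (perp S) = S"
proof -
  have "vec.dim (perp (perp S)) = vec.dim S"
    using dim_perp[of S] dim_perp[of "perp S"] by linarith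
  moreover have "S \<subseteq> perp (perp S)" using subset_perp_iff by blast
  ultimately show ?thesis
    using vec.subspace_dim_equal[OF assms subspace_perp] by (metis order_refl)
qed

section \<open>Sums of subspaces and the subspace metric under duality\<close>

lemma subspace_subspace_sum:
  "vec.subspace U \<Longrightarrow> vec.subspace W \<Longrightarrow> vec.subspace (subspace_sum U W)"
  unfolding subspace_sum_def by (rule vec.subspace_sums)

lemma dim_subspace_sum:
  assumes "vec.subspace U" "vec.subspace W"
  shows "vec.dim (subspace_sum U W) + vec.dim (U \<inter> W) = vec.dim U + vec.dim W"
  unfolding subspace_sum_def using assms by (rule vec.dim_sums_Int)

lemma subset_subspace_sum:
  assumes "vec.subspace U" "vec.subspace W"
  shows "U \<subseteq> subspace_sum U W" "W \<subseteq> subspace_sum U W"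
  unfolding subspace_sum_def using assms[THEN vec.subspace_0] by force+

lemma perp_subspace_sum:
  assumes "vec.subspace U" "vec.subspace W"
  shows "perp (subspace_sum U W) = perp U \<inter> perp W"
proof
  show "perp (subspace_sum U W) \<subseteq> perp U \<inter> perp W"
    using subset_subspace_sum[OF assms] perp_antimono by blast
  show "perp U \<inter> perp W \<subseteq> perp (subspace_sum U W)"
    by (auto simp: perp_def subspace_sum_def dot_algebra)
qed

lemma subspace_dist_eq:
  assumes "vec.subspace U" "vec.subspace W"
  shows "subspace_dist U W = int (vec.dim U) + int (vec.dim W) - 2 * int (vec.dim (U \<inter> W))"
  using dim_subspace_sum[OF assms] by (simp add: subspace_dist_def)

text \<open>Duality exchanges sums with intersections and replaces each dimension by its
  codimension; the ambient dimension cancels in the distance.\<close>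

lemma subspace_dist_perp:
  fixes U W :: "('k::{field,finite} ^ 'n::finite) set"
  assumes "vec.subspace U" "vec.subspace W"
  shows "subspace_dist (perp U) (perp W) = subspace_dist U W"
  using subspace_dist_eq[OF assms] subspace_dist_eq[OF subspace_perp subspace_perp, of U W]
    dim_perp[of U] dim_perp[of W] dim_subspace_sum[OF assms]
    dim_perp[of "subspace_sum U W"]
  unfolding perp_subspace_sum[OF assms] by linarith

lemma is_subspace_code_perp:
  fixes C :: "('k::{field,finite} ^ 'n::finite) set set"
  assumes "is_subspace_code C d"
  shows "is_subspace_code (perp ` C) d"
  using assms unfolding is_subspace_code_def
  by (auto simp: subspace_perp subspace_dist_perp)

section \<open>Counting points and lines through vectors\<close>

lemma card_subspace_nonzero:
  fixes S :: "('k::{field,finite} ^ 'n::finite) set"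
  assumes "vec.subspace S"
  shows "card (S - {0}) = CARD('k) ^ vec.dim S - 1"
  using vec.subspace_0[OF assms] card_subspace[OF assms] by simp

text \<open>Such a pair is an ordered basis of a line. The second vector must avoid the span of the
  first, which has \<open>CARD('k)\<close> elements.\<close>

lemma card_independent_pairs:
  fixes S :: "('k::{field,finite} ^ 'n::finite) set"
  assumes "vec.subspace S"
  shows "card (S \<times> S \<inter> {(u, v). u \<noteq> 0 \<and> v \<notin> vec.span {u}})
    = (CARD('k) ^ vec.dim S - 1) * (CARD('k) ^ vec.dim S - CARD('k))"
proof -
  have eq: "S \<times> S \<inter> {(u, v). u \<noteq> 0 \<and> v \<notin> vec.span {u}} = Sigma (S - {0}) (\<lambda>u. S - vec.span {u})"
    by auto
  have "card (S - vec.span {u}) = CARD('k) ^ vec.dim S - CARD('k)" if "u \<in> S - {0}" for u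
  proof -
    have "vec.span {u} \<subseteq> S" using that assms by (simp add: vec.span_minimal)
    moreover have "card (vec.span {u}) = CARD('k)"
      using that card_subspace[OF vec.subspace_span, of "{u}"] by simp
    ultimately show ?thesis
      by (simp add: card_Diff_subset card_subspace[OF assms])
  qed
  then show ?thesis unfolding eq using card_subspace_nonzero[OF assms] by simp
qed

text \<open>Let f(x) be the total weight of the sets \<open>g i\<close> containing x. The left side
  is the squared sum of f over \<open>T\<close>, and the double sum on the right is the sum of the
  squares of f, expanded over pairs of indices.\<close>

lemma weighted_incidence_Cauchy_Schwarz:
  fixes w :: "'i \<Rightarrow> real" and g :: "'i \<Rightarrow> 'a set"
  assumes "finite C" "finite T"
  shows "(\<Sum>i\<in>C. w i * card (T \<inter> g i))\<^sup>2
    \<le> card T * (\<Sum>i\<in>C. \<Sum>j\<in>C. w i * w j * card (T \<inter> g i \<inter> g j))"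
proof -
  have card_eq: "real (card (T \<inter> A)) = (\<Sum>x\<in>T. of_bool (x \<in> A))" for A
    using assms(2) by (simp add: Int_def)
  have "(\<Sum>i\<in>C. w i * card (T \<inter> g i)) = (\<Sum>x\<in>T. 1 * (\<Sum>i\<in>C. w i * of_bool (x \<in> g i)))"
    unfolding card_eq mult_1 sum_distrib_left sum.swap[of _ T] ..
  also have "\<dots>\<^sup>2 \<le> (\<Sum>x\<in>T. 1\<^sup>2) * (\<Sum>x\<in>T. (\<Sum>i\<in>C. w i * of_bool (x \<in> g i))\<^sup>2)"
    by (rule Cauchy_Schwarz_ineq_sum)
  also have "(\<Sum>x\<in>T. (\<Sum>i\<in>C. w i * of_bool (x \<in> g i))\<^sup>2)
    = (\<Sum>x\<in>T. \<Sum>i\<in>C. \<Sum>j\<in>C. w i * w j * of_bool (x \<in> g i \<inter> g j))"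
    unfolding power2_eq_square sum_product Int_iff of_bool_conj by (simp only: mult_ac)
  also have "\<dots> = (\<Sum>i\<in>C. \<Sum>j\<in>C. w i * w j * card (T \<inter> g i \<inter> g j))"
    unfolding Int_assoc card_eq sum_distrib_left sum.swap[of _ T] ..
  finally show ?thesis by simp
qed

section \<open>Codewords of dimension 4 within a hyperplane and around a fixed codeword\<close>

text \<open>Second moment of the number of codewords through a nonzero vector of \<open>H\<close>:
  each codeword has \<open>q ^ 4 - 1\<close> of these vectors, and two of them share at most
  \<open>q ^ 2 - 1\<close>.\<close>

lemma card_hyperplane_code_le:
  fixes H :: "('k::{field,finite} ^ 'n::finite) set" and D :: "('k ^ 'n) set set"
  assumes H: "vec.subspace H" "vec.dim H = 6"
    and D: "\<And>W. W \<in> D \<Longrightarrow> vec.subspace W \<and> vec.dim W = 4 \<and> W \<subseteq> H"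
    and Int: "\<And>W W'. W \<in> D \<Longrightarrow> W' \<in> D \<Longrightarrow> W \<noteq> W' \<Longrightarrow> vec.dim (W \<inter> W') \<le> 2"
  shows "real (card D) \<le> real CARD('k) ^ 4 + real CARD('k) ^ 2 + 1"
proof (cases "D = {}")
  case False
  define q where "q = real CARD('k)"
  define n where "n = real (card D)"
  have q: "q > 1" using one_less_CARD_field[where 'k='k] by (simp add: q_def)
  have fin: "finite D" "finite (H - {0})" by simp_all
  have card_nz: "real (card (S - {0})) = q ^ vec.dim S - 1"
    if "vec.subspace S" for S :: "('k^'n) set"
    using card_subspace_nonzero[OF that] by (simp add: q_def of_nat_diff)
  have meet: "(H - {0}) \<inter> W = W - {0}" if "W \<in> D" for W
    using D[OF that] by blast
  have "(\<Sum>W\<in>D. 1 * real (card ((H - {0}) \<inter> W))) = (\<Sum>W\<in>D. q ^ 4 - 1)"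
    by (rule sum.cong) (simp_all add: meet card_nz D)
  then have lhs: "(\<Sum>W\<in>D. 1 * real (card ((H - {0}) \<inter> W))) = n * (q ^ 4 - 1)"
    by (simp add: n_def)
  have inner: "(\<Sum>W'\<in>D. 1 * 1 * real (card ((H - {0}) \<inter> W \<inter> W')))
      \<le> (q ^ 4 - 1) + (n - 1) * (q ^ 2 - 1)" if W: "W \<in> D" for W
  proof -
    have "real (card ((H - {0}) \<inter> W \<inter> W')) \<le> q ^ 2 - 1" if W': "W' \<in> D - {W}" for W'
    proof -
      have "(H - {0}) \<inter> W \<inter> W' = (W \<inter> W') - {0}" using D[OF W] by blast
      then have "real (card ((H - {0}) \<inter> W \<inter> W')) = q ^ vec.dim (W \<inter> W') - 1"
        using D[OF W] W' D[of W'] by (simp add: card_nz vec.subspace_inter)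
      also have "\<dots> \<le> q ^ 2 - 1"
        using Int[OF W, of W'] W' q by (auto intro: power_increasing)
      finally show ?thesis .
    qed
    then have "(\<Sum>W'\<in>D - {W}. real (card ((H - {0}) \<inter> W \<inter> W'))) \<le> (\<Sum>W'\<in>D - {W}. q ^ 2 - 1)"
      by (rule sum_mono)
    also have "(\<Sum>W'\<in>D - {W}. q ^ 2 - 1) = (n - 1) * (q ^ 2 - 1)"
    proof -
      have "card D \<ge> 1" using W fin by (metis One_nat_def Suc_leI card_gt_0_iff empty_iff)
      then show ?thesis using W fin by (simp add: n_def of_nat_diff)
    qed
    finally have "(\<Sum>W'\<in>D - {W}. real (card ((H - {0}) \<inter> W \<inter> W'))) \<le> (n - 1) * (q ^ 2 - 1)" .
    moreover have "real (card ((H - {0}) \<inter> W \<inter> W)) = q ^ 4 - 1"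
    proof -
      have "(H - {0}) \<inter> W \<inter> W = W - {0}" using D[OF W] by blast
      then show ?thesis using card_nz[of W] D[OF W] by metis
    qed
    ultimately show ?thesis
      using sum.remove[OF fin(1) W, of "\<lambda>W'. real (card ((H - {0}) \<inter> W \<inter> W'))"]
      unfolding mult_1 by linarith
  qed
  have "(n * (q ^ 4 - 1))\<^sup>2 \<le> (q ^ 6 - 1) * (\<Sum>W\<in>D. \<Sum>W'\<in>D. 1 * 1 * real (card ((H - {0}) \<inter> W \<inter> W')))"
    using weighted_incidence_Cauchy_Schwarz[OF fin, of "\<lambda>_. 1" "\<lambda>W. W"] lhs H
    by (simp add: card_nz)
  also have "\<dots> \<le> (q ^ 6 - 1) * (\<Sum>W\<in>D. (q ^ 4 - 1) + (n - 1) * (q ^ 2 - 1))"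
    using inner q by (intro mult_left_mono sum_mono) auto
  also have "\<dots> = (q ^ 6 - 1) * (n * ((q ^ 4 - 1) + (n - 1) * (q ^ 2 - 1)))"
    by (simp add: n_def)
  finally have "0 \<le> (q ^ 6 - 1) * (n * ((q ^ 4 - 1) + (n - 1) * (q ^ 2 - 1))) - (n * (q ^ 4 - 1))\<^sup>2"
    by simp
  \<comment> \<open>The quadratic inequality in \<open>n\<close> factors completely, and the first
    factor is positive for nonempty \<open>D\<close>, so the sign of the last one gives the
    bound.\<close>
  also have "\<dots> = (n * (q\<^sup>2 - 1)\<^sup>2 * q\<^sup>2) * (q ^ 4 + q ^ 2 + 1 - n)"
    by algebra
  finally have "0 \<le> (n * (q\<^sup>2 - 1)\<^sup>2 * q\<^sup>2) * (q ^ 4 + q ^ 2 + 1 - n)" .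
  moreover have "n * (q\<^sup>2 - 1)\<^sup>2 * q\<^sup>2 > 0"
  proof -
    have "q\<^sup>2 - 1 > 0" using q by simp
    moreover have "n > 0" using False fin by (simp add: n_def card_gt_0_iff)
    ultimately show ?thesis using q by (intro mult_pos_pos zero_less_power) auto
  qed
  ultimately have "0 \<le> q ^ 4 + q ^ 2 + 1 - n" using zero_le_mult_iff not_less by blast
  then show ?thesis by (simp add: n_def q_def)
qed simp

lemma subset_perp_singleton_iff: "W \<subseteq> perp {y} \<longleftrightarrow> y \<in> perp W"
  using subset_perp_iff[of W "{y}"] by simp

lemma dim_perp_singleton:
  fixes y :: "'k::{field,finite} ^ 'n::finite"
  assumes "y \<noteq> 0"
  shows "vec.dim (perp {y}) = CARD('n) - 1"
  using dim_perp[of "{y}"] assms by simp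

text \<open>Double counting of pairs of a nonzero normal \<open>y\<close> of \<open>W\<close> and
  another codeword inside \<open>perp {y}\<close>. A codeword meeting \<open>W\<close> in dimension
  2 spans a hyperplane with it and so has \<open>q - 1\<close> such normals, while \<open>W\<close>
  has \<open>q ^ 3 - 1\<close> nonzero normals in all.\<close>

lemma card_meeting_in_line_le:
  fixes D :: "('k::{field,finite} ^ 'n::finite) set set"
  assumes n: "CARD('n) = 7"
    and D: "\<And>W. W \<in> D \<Longrightarrow> vec.subspace W \<and> vec.dim W = 4"
    and Int: "\<And>W W'. W \<in> D \<Longrightarrow> W' \<in> D \<Longrightarrow> W \<noteq> W' \<Longrightarrow> vec.dim (W \<inter> W') \<le> 2"
    and W: "W \<in> D"
  shows "(real CARD('k) - 1) * real (card {W' \<in> D - {W}. vec.dim (W \<inter> W') = 2})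
    \<le> (real CARD('k) ^ 3 - 1) * (real CARD('k) ^ 4 + real CARD('k) ^ 2)"
proof -
  define q where "q = real CARD('k)"
  have q: "q > 1" using one_less_CARD_field[where 'k='k] by (simp add: q_def)
  let ?Y = "perp W - {0}"
  let ?M = "{W' \<in> D - {W}. vec.dim (W \<inter> W') = 2}"
  have dimW: "vec.dim (perp W) = 3" using dim_perp[of W] D[OF W] n by simp
  then have cardY: "real (card ?Y) = q ^ 3 - 1"
    using card_subspace_nonzero[OF subspace_perp, of W] by (simp add: q_def of_nat_diff)
  have hyper: "real (card {W' \<in> D - {W}. W' \<subseteq> perp {y}}) \<le> q ^ 4 + q ^ 2" if y: "y \<in> ?Y" for y
  proof -
    \<comment> \<open>\<open>W\<close> itself lies in this hyperplane, so the bound for the other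
      codewords there drops by one.\<close>
    have eq: "{W' \<in> D. W' \<subseteq> perp {y}} = insert W {W' \<in> D - {W}. W' \<subseteq> perp {y}}"
      using W y by (auto simp: subset_perp_singleton_iff)
    have "real (card {W' \<in> D. W' \<subseteq> perp {y}}) \<le> q ^ 4 + q ^ 2 + 1"
      unfolding q_def using y D Int n
      by (intro card_hyperplane_code_le[OF subspace_perp]) (auto simp: dim_perp_singleton)
    then show ?thesis unfolding eq by simp
  qed
  have line: "real (card {y \<in> ?Y. W' \<subseteq> perp {y}}) = q - 1" if W': "W' \<in> ?M" for W'
  proof -
    have sub: "vec.subspace W" "vec.subspace W'" using W' W D by auto
    have "vec.dim (subspace_sum W W') = 6"
      using dim_subspace_sum[OF sub] W' W D by auto
    then have "vec.dim (perp (subspace_sum W W')) = 1"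
      using dim_perp[of "subspace_sum W W'"] n by simp
    moreover have "{y \<in> ?Y. W' \<subseteq> perp {y}} = perp (subspace_sum W W') - {0}"
      unfolding perp_subspace_sum[OF sub] by (auto simp: subset_perp_singleton_iff)
    ultimately show ?thesis
      using card_subspace_nonzero[OF subspace_perp, of "subspace_sum W W'"]
      by (simp add: q_def of_nat_diff)
  qed
  have "(q - 1) * real (card ?M) = (\<Sum>W'\<in>?M. real (card {y \<in> ?Y. W' \<subseteq> perp {y}}))"
    using line by simp
  also have "\<dots> \<le> (\<Sum>W'\<in>D - {W}. real (card {y \<in> ?Y. W' \<subseteq> perp {y}}))"
    by (rule sum_mono2) auto
  also have "\<dots> = (\<Sum>y\<in>?Y. real (card {W' \<in> D - {W}. W' \<subseteq> perp {y}}))"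
    unfolding of_nat_sum[symmetric]
    by (subst sum_multicount_gen[where k = "\<lambda>y. card {W' \<in> D - {W}. W' \<subseteq> perp {y}}"]) auto
  also have "\<dots> \<le> (\<Sum>y\<in>?Y. q ^ 4 + q ^ 2)"
    by (rule sum_mono) (rule hyper)
  also have "\<dots> = (q ^ 3 - 1) * (q ^ 4 + q ^ 2)"
    using cardY by simp
  finally show ?thesis by (simp add: q_def)
qed

section \<open>Codes with dimensions 3 and 4\<close>

lemma subspace_codeD:
  assumes "is_subspace_code C d" "U \<in> C"
  shows "vec.subspace U"
    and "W \<in> C \<Longrightarrow> U \<noteq> W \<Longrightarrow> d + 2 * vec.dim (U \<inter> W) \<le> vec.dim U + vec.dim W"
proof -
  show sub: "vec.subspace U" using assms by (auto simp: is_subspace_code_def)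
  assume W: "W \<in> C" "U \<noteq> W"
  then have "vec.subspace W" "int d \<le> subspace_dist U W"
    using assms by (auto simp: is_subspace_code_def)
  then show "d + 2 * vec.dim (U \<inter> W) \<le> vec.dim U + vec.dim W"
    using subspace_dist_eq[OF sub] by fastforce
qed

text \<open>Cauchy-Schwarz over ordered bases of lines. Every codeword has weighted count
  \<open>\<kappa>\<close> and weighted overlaps summing to at most \<open>\<kappa>\<close>, so
  \<open>card C * \<kappa>\<close> is at most the number of all pairs.\<close>

lemma card_dim_3_4_code_le:
  fixes C :: "('k::{field,finite} ^ 'n::finite) set set"
  assumes n: "CARD('n) = 7" and C: "is_subspace_code C 4"
    and dims: "\<And>U. U \<in> C \<Longrightarrow> vec.dim U = 3 \<or> vec.dim U = 4"
  shows "(real CARD('k) ^ 3 - 1) * (real CARD('k) ^ 2 - 1) * real (card C)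
    \<le> (real CARD('k) ^ 7 - 1) * (real CARD('k) ^ 6 - 1)"
proof (cases "C = {}")
  case False
  define q where "q = real CARD('k)"
  have q: "q > 1" using one_less_CARD_field[where 'k='k] by (simp add: q_def)
  have q_nat: "CARD('k) \<ge> 1" using one_less_CARD_field[where 'k='k] by simp
  define T where "T = {(u :: 'k^'n, v). u \<noteq> 0 \<and> v \<notin> vec.span {u}}"
  define c where "c S = real (card (T \<inter> S \<times> S))" for S :: "('k^'n) set"
  have c: "c S = (q ^ vec.dim S - 1) * (q ^ vec.dim S - q)" if S: "vec.subspace S" "vec.dim S \<ge> 1" for S
  proof -
    \<comment> \<open>This keeps the natural-number subtraction in the pair count from truncating,
      so the formula carries over to the reals.\<close>
    have "CARD('k) ^ 1 \<le> CARD('k) ^ vec.dim S" using S(2) q_nat by (intro power_increasing) auto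
    then show ?thesis
      using card_independent_pairs[OF S(1)] q_nat
      by (simp add: c_def T_def q_def of_nat_diff Int_commute)
  qed
  have c_small: "c S = 0" if "vec.subspace S" "vec.dim S \<le> 1" for S
    using that c[of S] card_independent_pairs[OF that(1)]
    by (cases "vec.dim S") (auto simp: c_def T_def Int_commute)
  have c_Int: "real (card (T \<inter> U \<times> U \<inter> W \<times> W)) = c (U \<inter> W)" for U W
    unfolding c_def by (intro arg_cong[of _ _ "\<lambda>A. real (card A)"]) auto
  \<comment> \<open>With these weights every codeword has the same weighted number \<open>\<kappa>\<close> of pairs.\<close>
  define w where "w U = (if vec.dim U = 3 then 1 else 1 / (q\<^sup>2 + 1))" for U :: "('k^'n) set"
  define \<kappa> where "\<kappa> = (q ^ 3 - 1) * (q ^ 3 - q)"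
  have \<kappa>: "\<kappa> > 0"
  proof -
    have "q ^ 3 > 1" "q ^ 3 > q ^ 1"
      using q by (simp, intro power_strict_increasing) auto
    then show ?thesis by (simp add: \<kappa>_def)
  qed
  have q2: "q\<^sup>2 + 1 > 0" by (simp add: add_nonneg_pos)
  have fin: "finite C" "finite T" by simp_all
  have wc: "w U * real (card (T \<inter> U \<times> U)) = \<kappa>" if U: "U \<in> C" for U
  proof (cases "vec.dim U = 3")
    case True
    then show ?thesis using c[of U] subspace_codeD[OF C U] by (simp add: w_def \<kappa>_def c_def)
  next
    case False
    then have "c U = (q ^ 4 - 1) * (q ^ 4 - q)"
      using dims[OF U] c[of U] subspace_codeD[OF C U] by simp
    \<comment> \<open>A 4-space has \<open>q\<^sup>2 + 1\<close> times as many lines as a 3-space,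
      which the weight compensates.\<close>
    also have "\<dots> = (q\<^sup>2 + 1) * \<kappa>" unfolding \<kappa>_def by algebra
    finally show ?thesis using False q2 by (simp add: w_def c_def)
  qed
  \<comment> \<open>The diagonal term is \<open>w U * \<kappa>\<close>. In dimension 3 this is all
    of \<open>\<kappa>\<close>; in dimension 4 it leaves room for overlaps with other
    codewords.\<close>
  have inner: "(\<Sum>W\<in>C. w U * w W * real (card (T \<inter> U \<times> U \<inter> W \<times> W))) \<le> \<kappa>" if U: "U \<in> C" for U
  proof -
    have Int: "vec.subspace (U \<inter> W)" "4 + 2 * vec.dim (U \<inter> W) \<le> vec.dim U + vec.dim W"
      if "W \<in> C - {U}" for W
      using that subspace_codeD[OF C U] subspace_codeD[OF C, of W] by (auto intro: vec.subspace_inter)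
    have diag: "(\<Sum>W\<in>C. w U * w W * c (U \<inter> W))
        = w U * \<kappa> + (\<Sum>W\<in>C - {U}. w U * w W * c (U \<inter> W))"
      using sum.remove[OF fin(1) U, of "\<lambda>W. w U * w W * c (U \<inter> W)"] wc[OF U]
      by (simp add: c_def)
    show ?thesis
    proof (cases "vec.dim U = 3")
      case True
      \<comment> \<open>Here the dimensions sum to at most 7, so distance 4 leaves an intersection
        of dimension at most 1, which contains no line.\<close>
      have "c (U \<inter> W) = 0" if "W \<in> C - {U}" for W
        using Int[OF that] True dims[of W] that by (intro c_small) auto
      then show ?thesis using diag True by (simp add: c_Int w_def)
    next
      case False
      then have U4: "vec.dim U = 4" using dims[OF U] by simp
      let ?D = "{W \<in> C. vec.dim W = 4}"
      let ?M = "{W \<in> ?D - {U}. vec.dim (U \<inter> W) = 2}"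
      have "(q - 1) * real (card ?M) \<le> (q ^ 3 - 1) * (q ^ 4 + q ^ 2)"
        unfolding q_def
      proof (rule card_meeting_in_line_le[OF n])
        fix W W' assume W: "W \<in> ?D" "W' \<in> ?D" "W \<noteq> W'"
        show "vec.dim (W \<inter> W') \<le> 2"
          using subspace_codeD(2)[OF C, of W W'] W by simp
      qed (use U U4 subspace_codeD[OF C] in auto)
      \<comment> \<open>The factor turns \<open>q - 1\<close> into
        \<open>(q ^ 2 - 1) * (q ^ 2 - q)\<close>, the number of ordered bases of one line.\<close>
      then have "((q - 1) * real (card ?M)) * (q * (q\<^sup>2 - 1)) \<le> ((q ^ 3 - 1) * (q ^ 4 + q ^ 2)) * (q * (q\<^sup>2 - 1))"
        using q by (intro mult_right_mono) auto
      also have "\<dots> = \<kappa> * (q\<^sup>2 + 1) * q\<^sup>2" unfolding \<kappa>_def by algebra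
      also have "((q - 1) * real (card ?M)) * (q * (q\<^sup>2 - 1)) = real (card ?M) * ((q ^ 2 - 1) * (q ^ 2 - q))"
        by algebra
      finally have M: "real (card ?M) * ((q ^ 2 - 1) * (q ^ 2 - q)) \<le> \<kappa> * (q\<^sup>2 + 1) * q\<^sup>2" .
      have wU: "w U = 1 / (q\<^sup>2 + 1)" using U4 by (simp add: w_def)
      have "w U * w W * c (U \<inter> W) = (if W \<in> ?M then (w U)\<^sup>2 * ((q ^ 2 - 1) * (q ^ 2 - q)) else 0)"
        if W: "W \<in> C - {U}" for W
      proof (cases "W \<in> ?M")
        case True
        then show ?thesis using c[OF Int(1)[OF W]] wU by (simp add: w_def power2_eq_square)
      next
        case False
        then have "vec.dim (U \<inter> W) \<le> 1" using Int(2)[OF W] dims[of W] W U4 by auto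
        then show ?thesis using False c_small[OF Int(1)[OF W]] by simp
      qed
      then have "(\<Sum>W\<in>C - {U}. w U * w W * c (U \<inter> W))
          = (\<Sum>W\<in>C - {U}. if W \<in> ?M then (w U)\<^sup>2 * ((q ^ 2 - 1) * (q ^ 2 - q)) else 0)"
        by (rule sum.cong[OF refl])
      also have "\<dots> = (\<Sum>W\<in>?M. (w U)\<^sup>2 * ((q ^ 2 - 1) * (q ^ 2 - q)))"
        by (rule sum.mono_neutral_cong_right) auto
      also have "\<dots> = (w U)\<^sup>2 * (real (card ?M) * ((q ^ 2 - 1) * (q ^ 2 - q)))"
        by simp
      also have "\<dots> \<le> (w U)\<^sup>2 * (\<kappa> * (q\<^sup>2 + 1) * q\<^sup>2)"
        using M by (rule mult_left_mono) simp
      \<comment> \<open>The overlap bound is exactly what the diagonal term leaves of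
        \<open>\<kappa>\<close>.\<close>
      also have "\<dots> = \<kappa> - w U * \<kappa>"
      proof -
        have "(q\<^sup>2 + 1) * w U = 1" using q2 by (simp add: wU)
        then show ?thesis by algebra
      qed
      finally show ?thesis using diag by (simp add: c_Int)
    qed
  qed
  have card_T: "real (card T) = (q ^ 7 - 1) * (q ^ 7 - q)"
    using c[of UNIV] n by (simp add: c_def vec_dim_card del: vec.dim_UNIV)
  have "(real (card C) * \<kappa>)\<^sup>2 = (\<Sum>U\<in>C. w U * real (card (T \<inter> U \<times> U)))\<^sup>2"
    using wc by simp
  also have "\<dots> \<le> real (card T) * (\<Sum>U\<in>C. \<Sum>W\<in>C. w U * w W * real (card (T \<inter> U \<times> U \<inter> W \<times> W)))"
    by (rule weighted_incidence_Cauchy_Schwarz[OF fin])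
  also have "\<dots> \<le> real (card T) * (\<Sum>U\<in>C. \<kappa>)"
    using inner by (intro mult_left_mono sum_mono) auto
  finally have "(real (card C) * \<kappa>) * (real (card C) * \<kappa>) \<le> real (card T) * (real (card C) * \<kappa>)"
    by (simp add: power2_eq_square)
  moreover have "real (card C) * \<kappa> > 0"
    using False fin \<kappa> by (simp add: card_gt_0_iff)
  ultimately have "real (card C) * \<kappa> \<le> real (card T)" by (rule mult_right_le_imp_le)
  \<comment> \<open>The common factor \<open>q\<close> comes from \<open>q ^ 3 - q\<close> in
    \<open>\<kappa>\<close> and \<open>q ^ 7 - q\<close> in the number of pairs.\<close>
  then have "q * ((q ^ 3 - 1) * (q ^ 2 - 1) * real (card C)) \<le> q * ((q ^ 7 - 1) * (q ^ 6 - 1))"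
    unfolding card_T \<kappa>_def by (simp add: algebra_simps power_numeral_reduce)
  then have "(q ^ 3 - 1) * (q ^ 2 - 1) * real (card C) \<le> (q ^ 7 - 1) * (q ^ 6 - 1)"
    using q by simp
  then show ?thesis by (simp add: q_def)
qed (use one_less_CARD_field[where 'k='k] in simp)

section \<open>Partial line spreads\<close>

lemma card_partial_line_spread_le:
  fixes D :: "('k::{field,finite} ^ 'n::finite) set set"
  assumes n: "CARD('n) = 7"
    and D: "\<And>L. L \<in> D \<Longrightarrow> vec.subspace L \<and> vec.dim L = 2"
    and Int: "\<And>L L'. L \<in> D \<Longrightarrow> L' \<in> D \<Longrightarrow> L \<noteq> L' \<Longrightarrow> L \<inter> L' = {0}"
  shows "card D \<le> CARD('k) ^ 5 + CARD('k) ^ 3 + 1"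
proof (rule ccontr)
  assume contra: "\<not> ?thesis"
  define q where "q = int CARD('k)"
  define e where "e = int (card D) - (q ^ 5 + q ^ 3 + 1)"
  have q: "q \<ge> 2" using one_less_CARD_field[where 'k='k] by (simp add: q_def)
  have "int (CARD('k) ^ 5 + CARD('k) ^ 3 + 1) < int (card D)" using contra by linarith
  then have e: "e \<ge> 1" by (simp add: e_def q_def)
  \<comment> \<open>The holes: nonzero vectors on no line of \<open>D\<close>, with
    \<open>q - 1\<close> of them for each uncovered point.\<close>
  define Hol where "Hol = - {0 :: 'k^'n} - \<Union>D"
  have card_nz: "int (card (S - {0})) = q ^ vec.dim S - 1"
    if "vec.subspace S" for S :: "('k^'n) set"
    using card_subspace_nonzero[OF that] one_less_CARD_field[where 'k='k]
    by (simp add: q_def of_nat_diff)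
  have part: "int (card (S - {0})) = int (card (Hol \<inter> S)) + (\<Sum>L\<in>D. int (card (L \<inter> S - {0})))" for S
  proof -
    have "S - {0} = (Hol \<inter> S) \<union> (\<Union>L\<in>D. L \<inter> S - {0})" by (auto simp: Hol_def)
    moreover have "card ((Hol \<inter> S) \<union> (\<Union>L\<in>D. L \<inter> S - {0}))
        = card (Hol \<inter> S) + card (\<Union>L\<in>D. L \<inter> S - {0})"
      by (rule card_Un_disjoint) (auto simp: Hol_def)
    moreover have "card (\<Union>L\<in>D. L \<inter> S - {0}) = (\<Sum>L\<in>D. card (L \<inter> S - {0}))"
    proof (rule card_UN_disjoint)
      show "\<forall>L\<in>D. \<forall>L'\<in>D. L \<noteq> L' \<longrightarrow> (L \<inter> S - {0}) \<inter> (L' \<inter> S - {0}) = {}"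
        using Int by blast
    qed simp_all
    ultimately show ?thesis by simp
  qed
  have card_Hol: "int (card Hol) = (q - 1) * (q\<^sup>2 - (q + 1) * e)"
  proof -
    have "(\<Sum>L\<in>D. int (card (L \<inter> UNIV - {0}))) = (\<Sum>L\<in>D. q\<^sup>2 - 1)"
      using D by (intro sum.cong) (auto simp: card_nz)
    moreover have "int (card (UNIV - {0 :: 'k^'n})) = q ^ 7 - 1"
      using card_nz[of UNIV] n by (simp add: vec_dim_card del: vec.dim_UNIV)
    ultimately have "int (card Hol) = q ^ 7 - 1 - int (card D) * (q\<^sup>2 - 1)"
      using part[of UNIV] by simp
    moreover have "int (card D) = q ^ 5 + q ^ 3 + 1 + e" by (simp add: e_def)
    ultimately show ?thesis by algebra
  qed
  have holes: "(q - 1) * (q - e) \<le> int (card (Hol \<inter> perp {y}))" if y: "y \<noteq> 0" for y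
  proof -
    let ?H = "perp {y}"
    define x where "x = int (card {L \<in> D. L \<subseteq> ?H})"
    have dimH: "vec.dim ?H = 6" using dim_perp_singleton[OF y] n by simp
    \<comment> \<open>A line lies in the hyperplane or meets it in one point. The excess of the
      first case is divisible by \<open>q\<close>, so the number \<open>x\<close> of contained lines
      drops out modulo \<open>q\<close>.\<close>
    have "int (card (L \<inter> ?H - {0})) = (q - 1) + (q\<^sup>2 - q) * of_bool (L \<subseteq> ?H)" if L: "L \<in> D" for L
    proof (cases "L \<subseteq> ?H")
      case True
      then show ?thesis using D[OF L] by (simp add: card_nz Int_absorb2)
    next
      case False
      have sub: "vec.subspace L" "vec.subspace ?H" using D[OF L] subspace_perp by auto
      have "vec.dim ?H < vec.dim (subspace_sum L ?H)"
      proof (rule vec.dim_psubset)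
        have "?H \<subset> subspace_sum L ?H" using False subset_subspace_sum[OF sub] by blast
        then show "vec.span ?H \<subset> vec.span (subspace_sum L ?H)"
          using sub subspace_subspace_sum[OF sub] vec.span_eq_iff by metis
      qed
      moreover have "vec.dim (subspace_sum L ?H) \<le> 7"
        using dim_subset_UNIV_cart_gen n by metis
      ultimately have "vec.dim (L \<inter> ?H) = 1"
        using dim_subspace_sum[OF sub] D[OF L] dimH by linarith
      then show ?thesis using False sub by (simp add: card_nz vec.subspace_inter)
    qed
    then have "(\<Sum>L\<in>D. int (card (L \<inter> ?H - {0}))) = (\<Sum>L\<in>D. (q - 1) + (q\<^sup>2 - q) * of_bool (L \<subseteq> ?H))"
      by (rule sum.cong[OF refl])
    also have "\<dots> = int (card D) * (q - 1) + (q\<^sup>2 - q) * x"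
      by (simp add: sum.distrib sum_distrib_left[symmetric] x_def Int_def)
    finally have "int (card (Hol \<inter> ?H)) = q ^ 6 - 1 - int (card D) * (q - 1) - (q\<^sup>2 - q) * x"
      using part[of ?H] card_nz[OF subspace_perp, of "{y}"] dimH by simp
    moreover have "int (card D) = q ^ 5 + q ^ 3 + 1 + e" by (simp add: e_def)
    \<comment> \<open>The second factor is congruent to \<open>- e\<close> modulo \<open>q\<close> and nonnegative, hence at least \<open>q - e\<close>.\<close>
    ultimately have eq: "int (card (Hol \<inter> ?H)) = (q - 1) * (q * (1 + q + q ^ 3 - x) - e)"
      by algebra
    then have "0 \<le> (q - 1) * (q * (1 + q + q ^ 3 - x) - e)" by (metis of_nat_0_le_iff)
    then have "0 < q * (1 + q + q ^ 3 - x)" using q e by (simp add: zero_le_mult_iff)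
    then have "1 \<le> 1 + q + q ^ 3 - x" using q by (simp add: zero_less_mult_iff)
    then have "q * 1 \<le> q * (1 + q + q ^ 3 - x)" using q by (intro mult_left_mono) auto
    then show ?thesis unfolding eq using q by (intro mult_left_mono) auto
  qed
  \<comment> \<open>Averaging: the hole bound is summed over all nonzero normals, and each hole is
    orthogonal to exactly \<open>q ^ 6 - 1\<close> of them.\<close>
  have "(q ^ 7 - 1) * ((q - 1) * (q - e)) = (\<Sum>y\<in>UNIV - {0 :: 'k^'n}. (q - 1) * (q - e))"
    using card_nz[of "UNIV :: ('k^'n) set"] n by (simp add: vec_dim_card del: vec.dim_UNIV)
  also have "\<dots> \<le> (\<Sum>y\<in>UNIV - {0}. int (card {v \<in> Hol. v \<in> perp {y}}))"
    using holes by (intro sum_mono) (auto simp: Int_def)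
  also have "\<dots> = (\<Sum>v\<in>Hol. int (card {y \<in> UNIV - {0}. v \<in> perp {y}}))"
    unfolding of_nat_sum[symmetric]
    by (subst sum_multicount_gen[where k = "\<lambda>v. card {y \<in> UNIV - {0}. v \<in> perp {y}}"]) auto
  also have "\<dots> = (\<Sum>v\<in>Hol. q ^ 6 - 1)"
  proof (rule sum.cong[OF refl])
    fix v assume "v \<in> Hol"
    then have "vec.dim (perp {v}) = 6" using dim_perp_singleton[of v] n by (simp add: Hol_def)
    moreover have "{y \<in> UNIV - {0}. v \<in> perp {y}} = perp {v} - {0}"
      by (auto simp: perp_def dot_commute)
    ultimately show "int (card {y \<in> UNIV - {0}. v \<in> perp {y}}) = q ^ 6 - 1"
      using card_nz[OF subspace_perp, of "{v}"] by simp
  qed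
  also have "\<dots> = (q ^ 6 - 1) * ((q - 1) * (q\<^sup>2 - (q + 1) * e))"
    by (simp add: card_Hol[symmetric])
  finally have "0 \<le> (q ^ 6 - 1) * ((q - 1) * (q\<^sup>2 - (q + 1) * e)) - (q ^ 7 - 1) * ((q - 1) * (q - e))"
    by simp
  also have "\<dots> = (q - 1) * ((q - 1) * (e - q) - (q ^ 6 - 1) * e)"
    by algebra
  \<comment> \<open>This is impossible for positive \<open>e\<close>: the right side is below
    \<open>(q - 1) * e\<close>, which is at most the left side.\<close>
  finally have "(q ^ 6 - 1) * e \<le> (q - 1) * (e - q)" using q by (simp add: zero_le_mult_iff)
  moreover have "(q - 1) * (e - q) < (q - 1) * e" using q by simp
  moreover have "(q - 1) * e \<le> (q ^ 6 - 1) * e"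
    using q e power_increasing[of 1 6 q] by (intro mult_right_mono) auto
  ultimately show False by linarith
qed

section \<open>Codewords of small and of large dimension\<close>

text \<open>A codeword of dimension at most 1 has distance at most 3 from any other subspace of
  dimension at most 2, so it is alone here. Otherwise all these codewords are lines, and distance 4
  makes them meet trivially.\<close>

lemma card_dim_le_2_code_le:
  fixes C :: "('k::{field,finite} ^ 'n::finite) set set"
  assumes n: "CARD('n) = 7" and C: "is_subspace_code C 4"
  shows "card {U \<in> C. vec.dim U \<le> 2} \<le> CARD('k) ^ 5 + CARD('k) ^ 3 + 1"
proof (cases "\<exists>U\<in>C. vec.dim U \<le> 1")
  case True
  then obtain U where U: "U \<in> C" "vec.dim U \<le> 1" by blast
  have "{U \<in> C. vec.dim U \<le> 2} \<subseteq> {U}"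
    using subspace_codeD(2)[OF C U(1)] U(2) by fastforce
  then have "card {U \<in> C. vec.dim U \<le> 2} \<le> card {U}" by (intro card_mono) auto
  then show ?thesis by simp
next
  case False
  show ?thesis
  proof (rule card_partial_line_spread_le[OF n])
    fix L assume L: "L \<in> {U \<in> C. vec.dim U \<le> 2}"
    then have "\<not> vec.dim L \<le> 1" using False by blast
    then show "vec.subspace L \<and> vec.dim L = 2" using L subspace_codeD(1)[OF C] by auto
  next
    fix L L' assume L: "L \<in> {U \<in> C. vec.dim U \<le> 2}" "L' \<in> {U \<in> C. vec.dim U \<le> 2}" "L \<noteq> L'"
    then have "vec.dim (L \<inter> L') = 0"
      using subspace_codeD(2)[OF C, of L L'] by (simp del: vec.dim_eq_0)
    then have "L \<inter> L' \<subseteq> {0}" by (simp only: vec.dim_eq_0)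
    then show "L \<inter> L' = {0}" using L subspace_codeD(1)[OF C] vec.subspace_0 by blast
  qed
qed

text \<open>\<open>perp\<close> is an isometry, is injective on subspaces as its own inverse, and
  sends dimension at least 5 to dimension at most 2.\<close>

lemma card_dim_ge_5_code_le:
  fixes C :: "('k::{field,finite} ^ 'n::finite) set set"
  assumes n: "CARD('n) = 7" and C: "is_subspace_code C 4"
  shows "card {U \<in> C. vec.dim U \<ge> 5} \<le> CARD('k) ^ 5 + CARD('k) ^ 3 + 1"
proof -
  have "card {U \<in> C. vec.dim U \<ge> 5} = card (perp ` {U \<in> C. vec.dim U \<ge> 5})"
    using subspace_codeD(1)[OF C]
    by (intro card_image[symmetric] inj_on_inverseI[of _ perp]) (auto simp: perp_perp)
  also have "\<dots> \<le> card {U \<in> perp ` C. vec.dim U \<le> 2}"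
  proof (rule card_mono)
    show "perp ` {U \<in> C. vec.dim U \<ge> 5} \<subseteq> {U \<in> perp ` C. vec.dim U \<le> 2}"
    proof clarify
      fix U assume "U \<in> C" "5 \<le> vec.dim U"
      then show "perp U \<in> perp ` C \<and> vec.dim (perp U) \<le> 2"
        using dim_perp[of U] n by auto
    qed
  qed simp
  also have "\<dots> \<le> CARD('k) ^ 5 + CARD('k) ^ 3 + 1"
    by (rule card_dim_le_2_code_le[OF n is_subspace_code_perp[OF C]])
  finally show ?thesis .
qed

section \<open>Combining the dimension ranges for an optimal code\<close>

theorem theorem3:
  fixes q :: nat
  assumes "primepow q"
    and "CARD('k::{field,finite}) = q"
  shows "real (subspace_code_max TYPE('k) TYPE(7) 4)
           \<le> (real q ^ 2 - real q + 1) * gauss_number q 7 + 2 * (real q ^ 5 + real q ^ 3 + 1)"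
proof -
  let ?codes = "{card C | C :: ('k ^ 7) set set. is_subspace_code C 4}"
  have "finite ?codes" by (rule finite_subset[of _ "range card"]) auto
  moreover have "?codes \<noteq> {}"
    by (auto simp: is_subspace_code_def intro!: exI[of _ "{}"])
  \<comment> \<open>The maximum is attained, so it suffices to bound one optimal code.\<close>
  ultimately have "subspace_code_max TYPE('k) TYPE(7) 4 \<in> ?codes"
    unfolding subspace_code_max_def by (rule Max_in)
  then obtain C :: "('k ^ 7) set set"
    where C: "is_subspace_code C 4" "subspace_code_max TYPE('k) TYPE(7) 4 = card C" by blast
  have n: "CARD(7) = 7" by simp
  let ?lo = "{U \<in> C. vec.dim U \<le> 2}" and ?hi = "{U \<in> C. vec.dim U \<ge> 5}"
    and ?mid = "{U \<in> C. vec.dim U = 3 \<or> vec.dim U = 4}"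
  have "C \<subseteq> ?lo \<union> ?hi \<union> ?mid"
  proof
    fix U assume "U \<in> C"
    moreover have "vec.dim U \<le> 2 \<or> vec.dim U \<ge> 5 \<or> vec.dim U = 3 \<or> vec.dim U = 4" by linarith
    ultimately show "U \<in> ?lo \<union> ?hi \<union> ?mid" by blast
  qed
  then have "card C \<le> card (?lo \<union> ?hi \<union> ?mid)" by (intro card_mono) auto
  also have "\<dots> \<le> card ?lo + card ?hi + card ?mid"
    using card_Un_le[of "?lo \<union> ?hi" ?mid] card_Un_le[of ?lo ?hi] by linarith
  finally have "card C \<le> 2 * (q ^ 5 + q ^ 3 + 1) + card ?mid"
    using card_dim_le_2_code_le[OF n C(1)] card_dim_ge_5_code_le[OF n C(1)] assms(2) by simp
  then have "real (card C) \<le> real (2 * (q ^ 5 + q ^ 3 + 1) + card ?mid)"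
    by (rule of_nat_mono)
  moreover have "real (card ?mid) \<le> (real q ^ 2 - real q + 1) * gauss_number q 7"
  proof -
    define r where "r = real q"
    have r: "r > 1" using one_less_CARD_field[where 'k='k] assms(2) by (simp add: r_def)
    have "is_subspace_code ?mid 4" using C(1) by (auto simp: is_subspace_code_def)
    then have "(r ^ 3 - 1) * (r ^ 2 - 1) * real (card ?mid) \<le> (r ^ 7 - 1) * (r ^ 6 - 1)"
      unfolding r_def assms(2)[symmetric] by (rule card_dim_3_4_code_le[OF n]) auto
    \<comment> \<open>This rests on
      \<open>r ^ 6 - 1 = (r ^ 3 - 1) * (r + 1) * (r ^ 2 - r + 1)\<close>.\<close>
    also have "\<dots> = (r ^ 3 - 1) * (r ^ 2 - 1) * ((r ^ 2 - r + 1) * ((r ^ 7 - 1) / (r - 1)))"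
    proof -
      have "(r ^ 2 - 1) * ((r ^ 7 - 1) / (r - 1)) = (r + 1) * (r ^ 7 - 1)"
        using r by (simp add: field_simps power2_eq_square)
      then show ?thesis by algebra
    qed
    finally have "real (card ?mid) \<le> (r ^ 2 - r + 1) * ((r ^ 7 - 1) / (r - 1))"
    proof (rule mult_left_le_imp_le)
      show "(r ^ 3 - 1) * (r ^ 2 - 1) > 0" using r by simp
    qed
    then show ?thesis by (simp add: r_def gauss_number_def)
  qed
  ultimately show ?thesis using C(2) by simp
qed

end
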